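(* Consider the commissionaire structure ($C$) described in the context, let $e_C^*$ be the headquarters' optimal effort level, let $\Delta\tau=\tau-\tau_0$ (varied with $\tau$ fixed), and let $\hat\alpha=\frac{\beta}{1-\beta}$. (i) If $\alpha\le\hat\alpha$, then $e_C^*$ is increasing in $\Delta\tau$. (ii) If $\alpha>\hat\alpha$, then $e_C^*$ may decrease in $\Delta\tau$; that is, there exist admissible model data with $\alpha>\hat\alpha$ for which $e_C^*$ is decreasing in $\Delta\tau$ on some interval of values of $\Delta\tau$.
   Context: A multinational firm has a headquarters, a retail division taxed at rate $\tau$ and a procurement division taxed at rate $\tau_0$, with $0\le\tau_0<\tau<1$. Parameters: retail price $m>0$, initial raw-material price $\gamma_0>0$, effect of effort $\eta>0$, effort cost coefficient $k>0$, markup $\alpha>0$, royalty fraction $\beta\in(0,1)$. Demand $D\ge 0$ is random with cumulative distribution function $F$ and density $f$; $F$ is strictly increasing on its support (an interval), with $f$ continuous and positive in its interior. Demand has an increasing generalized failure rate: $g(d)=\frac{d f(d)}{1-F(d)}$ is increasing in $d$. Expected sales at order quantity $y$ are $s(y)=\int_0^y x f(x)\,dx+\int_y^{\infty} y f(x)\,dx$. With effort $e\ge 0$ the unit purchase cost is $\gamma(e)=\gamma_0-\eta e$, the effort cost is $\frac12 k e^2$, and the transfer price is $T=(1+\alpha)\gamma(e)$. Operating parameters and effort are required to satisfy $\gamma(e)\le T\le m$ (in particular $\gamma(e)\ge 0$). Structure $C$ (full information). Given $e$, the retail division chooses $y_C(e)$ to maximize $\pi_C^R=m\,s(y)-(1+\alpha)(\gamma_0-\eta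 e)y$ over $y\ge 0$. Anticipating $y_C(e)$, the headquarters chooses $e\ge 0$ to maximize $$\pi_C^{HQ}=(1-\tau)\Big[(1-\beta)\pi_C^R-\tfrac12 k e^2\Big]+(1-\tau_0)\Big[\beta\pi_C^R-a+\alpha(\gamma_0-\eta e)y_C(e)\Big],$$ where the fixed salary is $a=0$. The optimal effort $e_C^*$ is the unique maximizer and is interior to the set of $e\ge 0$ satisfying $\gamma(e)\le T\le m$. "Admissible model data" means parameters $m,\gamma_0,\eta,k,\alpha>0$, $\beta\in(0,1)$, $0\le\tau_0<\tau<1$, $a=0$, and a distribution of the demand $D\ge 0$ with cumulative distribution function $F$ strictly increasing on its support (an interval), density $f$ continuous and positive in the interior of the support, and $g(d)=\frac{d f(d)}{1-F(d)}$ increasing in $d$, such that the requirement $\gamma(e)\le T\le m$ on operating parameters and effort is met and the headquarters' problem of maximizing $\pi_C^{HQ}$ has a unique maximizer $e_C^*$, which is interior to the set of $e\ge 0$ satisfying $\gamma(e)\le T\le m$. *)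

theory Defs
  imports "HOL-Probability.Probability"
begin

record model =
  price :: real        (* m *)
  cost0 :: real        (* gamma_0 *)
  effect :: real       (* eta *)
  effort_cost :: real  (* k *)
  markup :: real       (* alpha *)
  royalty :: real      (* beta *)
  tax :: real          (* tau, rate of the retail division *)
  tax0 :: real         (* tau_0, rate of the procurement division *)
  salary :: real       (* a *)
  demand :: "real measure"           (* law of D on the Borel sets of the real line *)
  demand_density :: "real \<Rightarrow> real"   (* f *)

abbreviation demand_cdf :: "model \<Rightarrow> real \<Rightarrow> real"
  where "demand_cdf M \<equiv> cdf (demand M)"

definition support :: "real measure \<Rightarrow> real set"
  where "support N = {x. \<forall>\<epsilon>>0. measure N (ball x \<epsilon>) > 0}"

definition gen_failure_rate :: "model \<Rightarrow> real \<Rightarrow> real"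
  where "gen_failure_rate M d = d * demand_density M d / (1 - demand_cdf M d)"

text \<open>The assumptions determine a density only up to null sets outside the interior of the
  support, so continuity, positivity and monotonicity of the generalized failure rate are required
  on that interior. As usual for increasing generalized failure rates, monotonicity is weak.\<close>

definition admissible_demand :: "model \<Rightarrow> bool"
  where "admissible_demand M \<longleftrightarrow>
    real_distribution (demand M) \<and>
    (AE x in demand M. 0 \<le> x) \<and>
    demand_density M \<in> borel_measurable borel \<and>
    (\<forall>x. 0 \<le> demand_density M x) \<and>
    demand M = density lborel (\<lambda>x. ennreal (demand_density M x)) \<and>
    is_interval (support (demand M)) \<and>
    strict_mono_on (support (demand M)) (demand_cdf M) \<and>
    continuous_on (interior (support (demand M))) (demand_density M) \<and>
    (\<forall>x \<in> interior (support (demand M)). 0 < demand_density M x) \<and>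
    mono_on (interior (support (demand M))) (gen_failure_rate M)"

definition expected_sales :: "model \<Rightarrow> real \<Rightarrow> real"
  where "expected_sales M y =
    (LBINT x:{0..y}. x * demand_density M x) + (LBINT x:{y..}. y * demand_density M x)"

definition unit_cost :: "model \<Rightarrow> real \<Rightarrow> real"
  where "unit_cost M e = cost0 M - effect M * e"

definition transfer_price :: "model \<Rightarrow> real \<Rightarrow> real"
  where "transfer_price M e = (1 + markup M) * unit_cost M e"

definition feasible_efforts :: "model \<Rightarrow> real set"
  where "feasible_efforts M =
    {e. 0 \<le> e \<and> unit_cost M e \<le> transfer_price M e \<and> transfer_price M e \<le> price M}"

definition retail_profit :: "model \<Rightarrow> real \<Rightarrow> real \<Rightarrow> real"
  where "retail_profit M e y =
    price M * expected_sales M y - (1 + markup M) * (cost0 M - effect M * e) * y"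

text \<open>The retail division's optimal order quantity is unique whenever the transfer price lies
  strictly between 0 and the retail price, in particular at interior feasible efforts.
  At transfer price 0 a maximizer need not exist (unbounded support), and at transfer price equal
  to the retail price every order up to the infimum of the support is optimal; there the choice
  operator picks an unspecified value.\<close>

definition order_quantity :: "model \<Rightarrow> real \<Rightarrow> real"
  where "order_quantity M e = arg_max_on (retail_profit M e) {0..}"

definition hq_profit :: "model \<Rightarrow> real \<Rightarrow> real"
  where "hq_profit M e =
    (1 - tax M) * ((1 - royalty M) * retail_profit M e (order_quantity M e)
      - 1/2 * effort_cost M * e^2) +
    (1 - tax0 M) * (royalty M * retail_profit M e (order_quantity M e) - salary M
      + markup M * (cost0 M - effect M * e) * order_quantity M e)"

definition optimal_effort :: "model \<Rightarrow> real"
  where "optimal_effort M = arg_max_on (hq_profit M) (feasible_efforts M)"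

definition admissible :: "model \<Rightarrow> bool"
  where "admissible M \<longleftrightarrow>
    0 < price M \<and> 0 < cost0 M \<and> 0 < effect M \<and> 0 < effort_cost M \<and> 0 < markup M \<and>
    0 < royalty M \<and> royalty M < 1 \<and>
    0 \<le> tax0 M \<and> tax0 M < tax M \<and> tax M < 1 \<and>
    salary M = 0 \<and>
    admissible_demand M \<and>
    (\<exists>!e. is_arg_max (hq_profit M) (\<lambda>e. e \<in> feasible_efforts M) e) \<and>
    optimal_effort M \<in> interior (feasible_efforts M)"

definition with_tax_gap :: "model \<Rightarrow> real \<Rightarrow> model"
  where "with_tax_gap M \<Delta> = M\<lparr>tax0 := tax M - \<Delta>\<rparr>"

definition markup_threshold :: "model \<Rightarrow> real"
  where "markup_threshold M = royalty M / (1 - royalty M)"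

end

theory Submission
  imports Defs
begin

text \<open>Varying the gap \<open>\<Delta>\<close> at a fixed tax rate \<open>\<tau>\<close> changes the headquarters' objective only through
  the procurement division: its after-tax weight is \<open>1 - \<tau> + \<Delta>\<close>, so the objective equals
  \<open>A(e) + \<Delta> B(e)\<close>, where \<open>B\<close> is the pre-tax profit of procurement (\<open>hq_profit_tax_gap\<close>). The sign
  of \<open>B'\<close> thus decides the direction in which the optimal effort moves.

  To compute \<open>B'\<close>, let \<open>T\<close> be the transfer price. The retail division faces a newsvendor problem
  whose solution \<open>y(e)\<close> is the quantile of the demand at the critical fractile \<open>1 - T/m\<close>
  (\<open>order_quantity_eq_quantile\<close>); its derivative is that of the inverse of the distribution
  function. The optimal retail profit \<open>\<pi>\<close> is a maximum of functions that are affine in \<open>e\<close>, so the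
  envelope theorem gives \<open>\<pi>'(e) = (1 + \<alpha>) \<eta> y(e)\<close>. Together,
  \<open>B'(e) = \<eta> ((\<beta> (1 + \<alpha>) - \<alpha>) y + \<alpha> (1 - F(y)) / f(y))\<close> (\<open>DERIV_procurement_profit\<close>).

  The first coefficient is nonnegative exactly when \<open>\<alpha> \<le> \<beta> / (1 - \<beta>)\<close>, and the second summand is
  positive. Hence in part (i) \<open>B\<close> is strictly increasing. Comparing the two maximizers by
  revealed preference shows that the effort cannot fall when \<open>\<Delta>\<close> rises, and comparing the two
  first-order conditions shows that it cannot stay the same
  (\<open>interior_maximizer_strict_increase\<close>).

  For part (ii), demand uniform on \<open>[0, 1]\<close> makes \<open>y\<close> affine in \<open>e\<close> and the whole objective a concave
  quadratic. With \<open>\<alpha> = 1\<close> and \<open>\<beta> = 1/4\<close>, \<open>B\<close> decreases once \<open>y > 2/3\<close>, that is once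
  \<open>(\<alpha> - \<beta> (1 + \<alpha>)) y\<close> outweighs \<open>\<alpha> (1 - F(y)) / f(y)\<close>, and the remaining parameters place the
  optimum in that region.\<close>

section \<open>The newsvendor problem of the retail division\<close>

text \<open>Meaningful for \<open>0 < p < 1\<close>, where the distribution function takes the value \<open>p\<close> exactly once.\<close>
definition quantile :: "model \<Rightarrow> real \<Rightarrow> real"
  where "quantile M p = (THE y. demand_cdf M y = p)"

context
  fixes M :: model
  assumes demand: "admissible_demand M"
begin

interpretation D: real_distribution "demand M"
  using demand unfolding admissible_demand_def by blast

lemma density_facts:
  "demand_density M \<in> borel_measurable borel" "0 \<le> demand_density M x"
  "demand M = density lborel (\<lambda>x. ennreal (demand_density M x))"
  "AE x in demand M. 0 \<le> x"
  using demand by (auto simp: admissible_demand_def)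

lemmas density_measurable[measurable] = density_facts(1)

lemma no_atoms: "AE x in demand M. x \<noteq> y"
  unfolding density_facts(3)
  by (subst AE_density) (auto intro: AE_mp[OF AE_lborel_singleton[of y]])

lemma measure_singleton: "measure (demand M) {y} = 0"
  using no_atoms[of y] D.prob_eq_0[of "{y}"] by simp

lemma isCont_cdf_demand: "isCont (demand_cdf M) y"
  using D.isCont_cdf measure_singleton by simp

lemma cdf_negative: "y < 0 \<Longrightarrow> demand_cdf M y = 0"
proof -
  assume "y < 0"
  then have "AE x in demand M. x \<notin> {..y}"
    using density_facts(4) by (auto elim: eventually_mono)
  then show ?thesis
    unfolding cdf_def using D.prob_eq_0[of "{..y}"] by simp
qed

lemma integrable_min: "0 \<le> y \<Longrightarrow> integrable (demand M) (\<lambda>x. min x y)"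
  by (rule D.integrable_const_bound[where B=y]) (use density_facts(4) in auto)

text \<open>The two integrals in the definition of expected sales overlap at the single point \<open>y\<close>, which has
  probability zero. As an expectation of \<open>min D y\<close>, expected sales inherit pointwise inequalities
  for \<open>min\<close>.\<close>
lemma expected_sales_eq_expectation_min:
  assumes "0 \<le> y"
  shows "expected_sales M y = (\<integral>x. min x y \<partial>demand M)"
proof -
  have 1: "(LBINT x:{0..y}. x * demand_density M x) = (\<integral>x. indicator {0..y} x * x \<partial>demand M)"
    by (subst density_facts(3), subst integral_density)
      (auto simp: density_facts set_lebesgue_integral_def mult_ac)
  have 2: "(LBINT x:{y..}. y * demand_density M x) = (\<integral>x. indicator {y..} x * y \<partial>demand M)"
    by (subst density_facts(3), subst integral_density)
      (auto simp: density_facts set_lebesgue_integral_def mult_ac)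
  have i1: "integrable (demand M) (\<lambda>x. indicator {0..y} x * x)"
    by (rule D.integrable_const_bound[where B=y]) (use assms in \<open>auto simp: indicator_def\<close>)
  have i2: "integrable (demand M) (\<lambda>x. indicator {y..} x * y)"
    by (rule D.integrable_const_bound[where B=y]) (use assms in \<open>auto simp: indicator_def\<close>)
  have "expected_sales M y = (\<integral>x. indicator {0..y} x * x + indicator {y..} x * y \<partial>demand M)"
    unfolding expected_sales_def 1 2 using i1 i2 by simp
  also have "\<dots> = (\<integral>x. min x y \<partial>demand M)"
  proof (rule integral_cong_AE)
    show "AE x in demand M. indicator {0..y} x * x + indicator {y..} x * y = min x y"
      using density_facts(4) no_atoms[of y] by eventually_elim (auto simp: indicator_def)
  qed auto
  finally show ?thesis .
qed

text \<open>An additional unit is sold only when demand exceeds \<open>y\<close>, so \<open>1 - F(y)\<close> is a supergradient of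
  expected sales at \<open>y\<close>. This replaces differentiation of expected sales: it yields both
  optimality and uniqueness of the newsvendor quantity.\<close>
lemma expected_sales_supergradient:
  assumes "0 \<le> y" "0 \<le> z"
  shows "expected_sales M z \<le> expected_sales M y + (1 - demand_cdf M y) * (z - y)"
proof -
  have i: "integrable (demand M) (\<lambda>x. indicator {y<..} x * (z - y))"
    by (rule D.integrable_const_bound[where B="\<bar>z-y\<bar>"]) (auto simp: indicator_def)
  have "(\<integral>x. min x z \<partial>demand M) \<le> (\<integral>x. min x y + indicator {y<..} x * (z - y) \<partial>demand M)"
    using integrable_min[OF assms(1)] integrable_min[OF assms(2)] i
    by (intro integral_mono) (auto simp: indicator_def)
  also have "\<dots> = (\<integral>x. min x y \<partial>demand M) + measure (demand M) {y<..} * (z - y)"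
    using integrable_min[OF assms(1)] i by simp
  also have "measure (demand M) {y<..} = 1 - demand_cdf M y"
  proof -
    have "{y<..} = space (demand M) - {..y}" by auto
    then show ?thesis unfolding cdf_def using D.prob_compl[of "{..y}"] by simp
  qed
  finally show ?thesis using assms by (simp add: expected_sales_eq_expectation_min)
qed

text \<open>Every point outside the support has a null neighbourhood, and by the Lindelof property countably
  many of them cover the complement of the support.\<close>
lemma null_of_disjoint_support:
  assumes [measurable]: "A \<in> sets borel" and disj: "A \<inter> support (demand M) = {}"
  shows "measure (demand M) A = 0"
proof -
  define \<F> where "\<F> = {B. \<exists>x e. B = ball x e \<and> 0 < e \<and> measure (demand M) B = 0}"
  have "\<And>S. S \<in> \<F> \<Longrightarrow> open S" by (auto simp: \<F>_def)
  then obtain \<F>' where \<F>': "\<F>' \<subseteq> \<F>" "countable \<F>'" "\<Union>\<F>' = \<Union>\<F>"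
    using Lindelof[of \<F>] by metis
  have "B \<in> null_sets (demand M)" if "B \<in> \<F>'" for B
    using that \<F>'(1) by (auto simp: \<F>_def null_sets_def D.emeasure_eq_measure)
  then have "(\<Union>B\<in>\<F>'. B) \<in> null_sets (demand M)"
    using \<F>'(2) by (intro null_sets_UN')
  then have "\<Union>\<F>' \<in> null_sets (demand M)" by simp
  moreover have "A \<subseteq> \<Union>\<F>'"
  proof
    fix x assume "x \<in> A"
    then obtain e where "0 < e" "\<not> measure (demand M) (ball x e) > 0"
      using disj by (auto simp: support_def)
    then have "ball x e \<in> \<F>" "x \<in> ball x e"
      using measure_nonneg[of "demand M" "ball x e"] by (auto simp: \<F>_def)
    then show "x \<in> \<Union>\<F>'" using \<F>'(3) by blast
  qed
  ultimately have "A \<in> null_sets (demand M)"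
    using null_sets_subset[of "\<Union>\<F>'" "demand M" A] by simp
  then show ?thesis by (rule measure_eq_0_null_sets)
qed

text \<open>Both \<open>{..<y}\<close> and \<open>{y<..}\<close> have positive probability and so meet the support, which is an interval.
  Hence the density is continuous and positive wherever the distribution function is strictly
  between 0 and 1.\<close>
lemma quantile_range_interior_support:
  assumes "0 < demand_cdf M y" "demand_cdf M y < 1"
  shows "y \<in> interior (support (demand M))"
proof -
  have "measure (demand M) {..<y} + measure (demand M) {y} = demand_cdf M y"
    unfolding cdf_def by (subst D.finite_measure_Union[symmetric])
      (auto intro: arg_cong[where f="measure (demand M)"])
  then have "measure (demand M) {..<y} \<noteq> 0" using assms measure_singleton by simp
  then obtain a where a: "a < y" "a \<in> support (demand M)"
    using null_of_disjoint_support[of "{..<y}"] by fastforce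
  have "{y<..} = space (demand M) - {..y}" by auto
  then have "measure (demand M) {y<..} = 1 - demand_cdf M y"
    unfolding cdf_def using D.prob_compl[of "{..y}"] by simp
  then have "measure (demand M) {y<..} \<noteq> 0" using assms by simp
  then obtain b where b: "y < b" "b \<in> support (demand M)"
    using null_of_disjoint_support[of "{y<..}"] by fastforce
  have "is_interval (support (demand M))" using demand unfolding admissible_demand_def by blast
  then have "{a<..<b} \<subseteq> support (demand M)"
    using mem_is_interval_1_I[OF _ a(2) b(2)] by (auto intro: less_imp_le)
  then show ?thesis using a b by (intro interiorI[of "{a<..<b}"]) auto
qed

lemma DERIV_cdf:
  assumes "y \<in> interior (support (demand M))"
  shows "(demand_cdf M has_real_derivative demand_density M y) (at y)" "0 < demand_density M y"
proof -
  let ?I = "interior (support (demand M))" and ?f = "demand_density M"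
  have "continuous_on ?I ?f" and pos: "\<forall>x\<in>?I. 0 < ?f x"
    using demand by (auto simp: admissible_demand_def)
  show "0 < ?f y" using pos assms by blast
  obtain d where d: "0 < d" "cball y d \<subseteq> ?I"
    using assms open_interior open_contains_cball by blast
  define a b where "a = y - d" and "b = y + d"
  have ab: "{a..b} \<subseteq> ?I" "a < y" "y < b" using d by (auto simp: a_def b_def cball_eq_atLeastAtMost)
  have cont: "continuous_on {a..b} ?f"
    using \<open>continuous_on ?I ?f\<close> ab(1) by (rule continuous_on_subset)
  have F: "demand_cdf M u = demand_cdf M a + integral {a..u} ?f" if u: "u \<in> {a..b}" for u
  proof -
    have "demand_cdf M u - demand_cdf M a = measure (demand M) {a<..u}"
      using u by (cases "a = u") (auto simp: D.cdf_diff_eq)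
    also have "\<dots> = (\<integral>x. indicator {a<..u} x \<partial>demand M)" by simp
    also have "\<dots> = (\<integral>x. ?f x * indicator {a<..u} x \<partial>lborel)"
      by (subst density_facts(3), subst integral_density) (auto simp: density_facts)
    also have "\<dots> = (LBINT x:{a..u}. ?f x)"
      unfolding set_lebesgue_integral_def
    proof (rule integral_cong_AE)
      show "AE x in lborel. ?f x * indicator {a<..u} x = indicator {a..u} x *\<^sub>R ?f x"
        using AE_lborel_singleton[of a] by eventually_elim (auto simp: indicator_def)
    qed auto
    also have "\<dots> = integral {a..u} ?f"
    proof (rule set_borel_integral_eq_integral, rule borel_integrable_atLeastAtMost')
      show "continuous_on {a..u} ?f" using u by (intro continuous_on_subset[OF cont]) auto
    qed
    finally show ?thesis by simp
  qed
  have "((\<lambda>u. demand_cdf M a + integral {a..u} ?f) has_real_derivative ?f y) (at y within {a..b})"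
    using integral_has_real_derivative[OF cont, of y] ab
    by (auto intro!: derivative_eq_intros)
  then have "(demand_cdf M has_real_derivative ?f y) (at y within {a..b})"
  proof (rule has_field_derivative_transform_within[OF _ zero_less_one])
    show "y \<in> {a..b}" using ab by simp
  qed (rule F[symmetric])
  moreover have "at y within {a..b} = at y" using ab by (intro at_within_interior) auto
  ultimately show "(demand_cdf M has_real_derivative ?f y) (at y)" by simp
qed

lemma cdf_inj:
  assumes "demand_cdf M y = demand_cdf M z" "0 < demand_cdf M y" "demand_cdf M y < 1"
  shows "y = z"
proof -
  have strict: "demand_cdf M u < demand_cdf M v"
    if "u < v" "0 < demand_cdf M u" "demand_cdf M v < 1" for u v
  proof (rule DERIV_pos_imp_increasing[OF \<open>u < v\<close>])
    fix x assume "u \<le> x" "x \<le> v"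
    then have "0 < demand_cdf M x" "demand_cdf M x < 1"
      using D.cdf_nondecreasing[of u x] D.cdf_nondecreasing[of x v] that by auto
    then show "\<exists>l. (demand_cdf M has_real_derivative l) (at x) \<and> 0 < l"
      using DERIV_cdf[OF quantile_range_interior_support[of x]] by auto
  qed
  show ?thesis
  proof (rule ccontr)
    assume "y \<noteq> z"
    then consider "y < z" | "z < y" by linarith
    then show False using strict[of y z] strict[of z y] assms by cases simp_all
  qed
qed

lemma cdf_quantile:
  assumes "0 < p" "p < 1"
  shows "demand_cdf M (quantile M p) = p"
proof -
  have "\<forall>\<^sub>F x in at_bot. demand_cdf M x < p"
    using order_tendstoD(2)[OF D.cdf_lim_at_bot assms(1)] .
  then obtain a where a: "demand_cdf M a < p"
    using eventually_happens'[OF trivial_limit_at_bot_linorder] by blast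
  have "\<forall>\<^sub>F x in at_top. p < demand_cdf M x"
    using order_tendstoD(1)[OF D.cdf_lim_at_top_prob assms(2)] .
  then obtain b where b: "p < demand_cdf M b"
    using eventually_happens'[OF trivial_limit_at_top_linorder] by blast
  have "a \<le> b"
  proof (rule ccontr)
    assume "\<not> a \<le> b"
    then have "demand_cdf M b \<le> demand_cdf M a" by (intro D.cdf_nondecreasing) simp
    then show False using a b by simp
  qed
  moreover have "continuous_on {a..b} (demand_cdf M)"
    using isCont_cdf_demand by (intro continuous_at_imp_continuous_on) blast
  ultimately obtain y where y: "demand_cdf M y = p"
    using IVT'[of "demand_cdf M" a p b, OF less_imp_le[OF a] less_imp_le[OF b]] by blast
  have "quantile M p = y"
    unfolding quantile_def
  proof (rule the_equality)
    show "demand_cdf M y = p" by (rule y)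
  next
    fix z assume "demand_cdf M z = p"
    then show "z = y" using cdf_inj[of z y] y assms by simp
  qed
  then show ?thesis using y by simp
qed

lemma quantile_cdf:
  assumes "0 < demand_cdf M y" "demand_cdf M y < 1"
  shows "quantile M (demand_cdf M y) = y"
  using cdf_inj[of "quantile M (demand_cdf M y)" y] cdf_quantile[OF assms] assms by simp

lemma quantile_nonneg: "0 < p \<Longrightarrow> p < 1 \<Longrightarrow> 0 \<le> quantile M p"
  using cdf_negative[of "quantile M p"] cdf_quantile[of p] by (cases "quantile M p < 0") auto

lemma DERIV_quantile:
  assumes "0 < p" "p < 1"
  shows "(quantile M has_real_derivative inverse (demand_density M (quantile M p))) (at p)"
    and "0 < demand_density M (quantile M p)"
proof -
  let ?U = "{y. 0 < demand_cdf M y \<and> demand_cdf M y < 1}"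
  have cont: "continuous_on A (demand_cdf M)" for A
    using isCont_cdf_demand by (auto intro: continuous_at_imp_continuous_on)
  have "open ?U"
    using cont by (intro open_Collect_conj open_Collect_less) (auto intro: continuous_intros)
  have q: "quantile M p \<in> ?U" using cdf_quantile assms by simp
  note D = DERIV_cdf[OF quantile_range_interior_support[of "quantile M p"]]
  show "0 < demand_density M (quantile M p)" using D(2) q by auto
  then have "(quantile M has_derivative (*) (inverse (demand_density M (quantile M p))))
      (at (demand_cdf M (quantile M p)))"
    using q quantile_cdf D(1)
    by (intro has_derivative_inverse_strong[OF \<open>open ?U\<close> q cont, of "quantile M"
          "(*) (demand_density M (quantile M p))"])
      (auto simp: has_field_derivative_def fun_eq_iff)
  then show "(quantile M has_real_derivative inverse (demand_density M (quantile M p))) (at p)"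
    using cdf_quantile assms by (simp add: has_field_derivative_def)
qed

text \<open>By concavity the first-order condition suffices for a maximum. It also covers a transfer price of 0,
  provided that demand is bounded by \<open>y\<close>.\<close>
lemma is_arg_max_retail_profit:
  assumes "0 \<le> y" and foc: "price M * (1 - demand_cdf M y) = transfer_price M e" and "0 < price M"
  shows "is_arg_max (retail_profit M e) (\<lambda>y. y \<in> {0..}) y"
proof -
  have "retail_profit M e z \<le> retail_profit M e y" if "0 \<le> z" for z
  proof -
    have "price M * expected_sales M z
        \<le> price M * (expected_sales M y + (1 - demand_cdf M y) * (z - y))"
      using expected_sales_supergradient[OF assms(1) that] assms(3) by simp
    also have "\<dots> = price M * expected_sales M y + transfer_price M e * (z - y)"
      by (simp add: foc[symmetric] algebra_simps)
    finally show ?thesis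
      by (simp add: retail_profit_def transfer_price_def unit_cost_def algebra_simps)
  qed
  then show ?thesis using assms by (auto simp: is_arg_max_def not_less)
qed

lemma retail_profit_supergradient:
  assumes "0 \<le> y" "0 \<le> z" "0 < price M"
  shows "retail_profit M e z \<le> retail_profit M e y
           + (price M * (1 - demand_cdf M y) - transfer_price M e) * (z - y)"
  using mult_left_mono[OF expected_sales_supergradient[OF assms(1,2)], of "price M"] assms(3)
  by (simp add: retail_profit_def transfer_price_def unit_cost_def algebra_simps)

text \<open>The order quantity is defined by a choice among maximizers, so the quantile has to be the only one.
  A second maximizer \<open>z\<close> is excluded by the supergradient inequality at the midpoint \<open>w\<close> of \<open>z\<close> and
  the quantile: there the slope of the retail profit is nonzero and points away from \<open>z\<close>.\<close>
lemma order_quantity_eq_quantile: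
  assumes T: "0 < transfer_price M e" "transfer_price M e < price M"
  shows "order_quantity M e = quantile M (1 - transfer_price M e / price M)"
    and "is_arg_max (retail_profit M e) (\<lambda>y. y \<in> {0..}) (order_quantity M e)"
proof -
  let ?p = "1 - transfer_price M e / price M" and ?R = "retail_profit M e"
  define q where "q = quantile M ?p"
  have m: "0 < price M" using T by simp
  have p: "0 < ?p" "?p < 1" using T m by auto
  have q: "0 \<le> q" "demand_cdf M q = ?p"
    using quantile_nonneg[OF p] cdf_quantile[OF p] by (auto simp: q_def)
  have max: "is_arg_max ?R (\<lambda>y. y \<in> {0..}) q"
    by (rule is_arg_max_retail_profit) (use q m in \<open>auto simp: field_simps\<close>)
  have "z = q" if z: "is_arg_max ?R (\<lambda>y. y \<in> {0..}) z" for z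
  proof (rule ccontr)
    assume "z \<noteq> q"
    define w where "w = (q + z) / 2"
    have nn: "0 \<le> z" "0 \<le> w" using z q by (auto simp: is_arg_max_def w_def)
    have "demand_cdf M w \<noteq> ?p"
      using cdf_inj[of q w] q p \<open>z \<noteq> q\<close> by (auto simp: w_def)
    moreover have "(demand_cdf M w - ?p) * (z - w) \<ge> 0"
    proof (cases "q < z")
      case True
      then have "q \<le> w" "w \<le> z" by (auto simp: w_def)
      then show ?thesis using D.cdf_nondecreasing[of q w] q by simp
    next
      case False
      then have "w \<le> q" "z \<le> w" by (auto simp: w_def)
      then show ?thesis using D.cdf_nondecreasing[of w q] q by (simp add: mult_nonpos_nonpos)
    qed
    moreover have "z \<noteq> w" using \<open>z \<noteq> q\<close> by (auto simp: w_def)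
    ultimately have "0 < (demand_cdf M w - ?p) * (z - w)" by (simp add: order_less_le)
    then have "0 < price M * ((demand_cdf M w - ?p) * (z - w))" using m by simp
    moreover have "(price M * (1 - demand_cdf M w) - transfer_price M e) * (z - w)
        = - (price M * ((demand_cdf M w - ?p) * (z - w)))"
      using m by (simp add: field_simps)
    ultimately have "?R z < ?R w"
      using retail_profit_supergradient[OF nn(2,1) m, of e] by simp
    then show False using z nn by (auto simp: is_arg_max_def)
  qed
  moreover have "is_arg_max ?R (\<lambda>y. y \<in> {0..}) (order_quantity M e)"
    unfolding order_quantity_def arg_max_on_def arg_max_def using max by (rule someI)
  ultimately show "order_quantity M e = quantile M ?p"
      "is_arg_max (retail_profit M e) (\<lambda>y. y \<in> {0..}) (order_quantity M e)"
    unfolding q_def by auto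
qed

section \<open>Profits as functions of the effort\<close>

lemma DERIV_order_quantity:
  assumes T: "0 < transfer_price M e" "transfer_price M e < price M"
  defines "y \<equiv> order_quantity M e"
  shows "(order_quantity M has_real_derivative
           (1 + markup M) * effect M / (price M * demand_density M y)) (at e)"
    and "0 \<le> y" and "0 < demand_density M y"
proof -
  let ?p = "\<lambda>e. 1 - transfer_price M e / price M"
  let ?J = "{e. 0 < transfer_price M e \<and> transfer_price M e < price M}"
  have m: "0 < price M" using T by simp
  have p: "0 < ?p e" "?p e < 1" using T m by auto
  have y: "y = quantile M (?p e)" using order_quantity_eq_quantile[OF T] y_def by simp
  show "0 \<le> y" "0 < demand_density M y"
    using quantile_nonneg[OF p] DERIV_quantile(2)[OF p] y by auto
  have p': "(?p has_real_derivative (1 + markup M) * effect M / price M) (at e)"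
  proof -
    have "?p = (\<lambda>e. 1 - (1 + markup M) * cost0 M / price M
        + ((1 + markup M) * effect M / price M) * e)"
      using m by (simp add: transfer_price_def unit_cost_def fun_eq_iff field_simps)
    then show ?thesis using m by (auto intro!: derivative_eq_intros)
  qed
  have "((\<lambda>e. quantile M (?p e)) has_real_derivative
           inverse (demand_density M y) * ((1 + markup M) * effect M / price M)) (at e)"
    using DERIV_chain2[OF DERIV_quantile(1)[OF p] p'] y by simp
  moreover have "open ?J"
    unfolding transfer_price_def unit_cost_def
    by (intro open_Collect_conj open_Collect_less continuous_intros)
  then have "\<forall>\<^sub>F x in nhds e. quantile M (?p x) = order_quantity M x"
    unfolding eventually_nhds using T order_quantity_eq_quantile(1) by (intro exI[of _ ?J]) auto
  ultimately show "(order_quantity M has_real_derivative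
           (1 + markup M) * effect M / (price M * demand_density M y)) (at e)"
    using DERIV_cong_ev[OF refl, of "\<lambda>x. quantile M (?p x)" "order_quantity M" e _ _, OF _ refl] m
    by (simp add: field_simps)
qed

text \<open>The envelope theorem: only the direct effect of effort on the transfer payment counts. Each order
  quantity is optimal at its own effort, so the profit gain between two efforts is squeezed between
  \<open>(1 + \<alpha>) \<eta> y\<close> times the effort difference, taken at the order quantities \<open>y\<close> of the two efforts; these
  converge to each other by continuity of the order quantity.\<close>
lemma DERIV_optimal_retail_profit:
  assumes T: "0 < transfer_price M e" "transfer_price M e < price M"
  shows "((\<lambda>e. retail_profit M e (order_quantity M e)) has_real_derivative
           (1 + markup M) * effect M * order_quantity M e) (at e)"
proof -
  let ?\<pi> = "\<lambda>e. retail_profit M e (order_quantity M e)" and ?c = "(1 + markup M) * effect M"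
  let ?J = "{e. 0 < transfer_price M e \<and> transfer_price M e < price M}"
  have shift: "retail_profit M x y = retail_profit M x' y + ?c * (x - x') * y" for x x' y
    by (simp add: retail_profit_def algebra_simps)
  have lower: "?\<pi> x' + ?c * (x - x') * order_quantity M x' \<le> ?\<pi> x" if "x \<in> ?J" "x' \<in> ?J" for x x'
    using order_quantity_eq_quantile(2)[of x] order_quantity_eq_quantile(2)[of x'] that
    by (auto simp: is_arg_max_def not_less simp flip: shift)
  have "isCont (order_quantity M) e" using DERIV_order_quantity(1)[OF T] by (rule DERIV_isCont)
  then have lim: "(\<lambda>x. \<bar>?c\<bar> * \<bar>order_quantity M x - order_quantity M e\<bar>) \<midarrow>e\<rightarrow> 0"
    unfolding isCont_def by (auto intro!: tendsto_eq_intros)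
  have "open ?J"
    unfolding transfer_price_def unit_cost_def
    by (intro open_Collect_conj open_Collect_less continuous_intros)
  then have "\<forall>\<^sub>F x in at e. x \<in> ?J"
    using T by (intro eventually_at_in_open') auto
  moreover have "\<forall>\<^sub>F x in at e. x \<noteq> e" by (simp add: eventually_at_filter)
  ultimately have "\<forall>\<^sub>F x in at e. norm ((?\<pi> x - ?\<pi> e) / (x - e) - ?c * order_quantity M e)
      \<le> \<bar>?c\<bar> * \<bar>order_quantity M x - order_quantity M e\<bar>"
  proof eventually_elim
    case (elim x)
    let ?r = "?\<pi> x - ?\<pi> e - ?c * (x - e) * order_quantity M e"
    have "0 \<le> ?r" using lower[of x e] elim T by simp
    moreover have "?r \<le> ?c * (x - e) * (order_quantity M x - order_quantity M e)"
      using lower[of e x] elim T by (simp add: algebra_simps)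
    ultimately have "\<bar>?r\<bar> \<le> \<bar>?c\<bar> * \<bar>order_quantity M x - order_quantity M e\<bar> * \<bar>x - e\<bar>"
      by (simp flip: abs_mult add: mult_ac)
    moreover have "(?\<pi> x - ?\<pi> e) / (x - e) - ?c * order_quantity M e = ?r / (x - e)"
      using elim by (simp add: field_simps)
    ultimately show ?case using elim by (simp add: abs_divide field_simps)
  qed
  then have "((\<lambda>x. (?\<pi> x - ?\<pi> e) / (x - e) - ?c * order_quantity M e) \<longlongrightarrow> 0) (at e)"
    using lim by (rule Lim_null_comparison)
  then show ?thesis unfolding has_field_derivative_iff by (rule LIM_zero_cancel)
qed

end

text \<open>The coefficient of \<open>1 - \<tau>\<^sub>0\<close> in the headquarters' objective.\<close>
definition procurement_profit :: "model \<Rightarrow> real \<Rightarrow> real"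
  where "procurement_profit M e = royalty M * retail_profit M e (order_quantity M e) - salary M
      + markup M * (cost0 M - effect M * e) * order_quantity M e"

text \<open>The royalty contributes \<open>\<beta> (1 + \<alpha>) \<eta> y\<close> by the envelope theorem. The markup revenue \<open>\<alpha> \<gamma>(e) y(e)\<close> loses
  \<open>\<alpha> \<eta> y\<close> through the lower unit cost and gains from the larger order; \<open>T / m\<close> in the result is the tail
  probability \<open>1 - F(y)\<close>.\<close>
lemma DERIV_procurement_profit:
  assumes "admissible_demand M" and T: "0 < transfer_price M e" "transfer_price M e < price M"
  defines "y \<equiv> order_quantity M e"
  shows "(procurement_profit M has_real_derivative
           effect M * ((royalty M * (1 + markup M) - markup M) * y
             + markup M * (transfer_price M e / price M) / demand_density M y)) (at e)"
proof -
  note dy = DERIV_order_quantity[OF assms(1) T, folded y_def]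
  note dpi = DERIV_optimal_retail_profit[OF assms(1) T]
  show ?thesis
    unfolding procurement_profit_def
    apply (rule derivative_eq_intros refl dy(1) dpi)+
    using dy(3) T
    by (simp add: y_def[symmetric] transfer_price_def unit_cost_def field_simps)
qed

text \<open>The threshold on the markup is exactly the condition \<open>\<beta> (1 + \<alpha>) - \<alpha> \<ge> 0\<close>: royalty income from cheaper
  procurement then makes up for the reduced markup per unit.\<close>
lemma DERIV_procurement_profit_pos:
  assumes "admissible_demand M" and T: "0 < transfer_price M e" "transfer_price M e < price M"
    and "0 < effect M" "0 < markup M" "royalty M < 1" "markup M \<le> markup_threshold M"
  shows "\<exists>l. (procurement_profit M has_real_derivative l) (at e) \<and> 0 < l"
proof -
  let ?y = "order_quantity M e"
  note y = DERIV_order_quantity(2,3)[OF assms(1) T]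
  have "0 \<le> royalty M * (1 + markup M) - markup M"
    using assms(6,7) by (simp add: markup_threshold_def pos_le_divide_eq algebra_simps)
  then have "0 \<le> (royalty M * (1 + markup M) - markup M) * ?y" using y by simp
  moreover have "0 < markup M * (transfer_price M e / price M) / demand_density M ?y"
    using y T assms by (intro divide_pos_pos mult_pos_pos) auto
  ultimately show ?thesis
    using DERIV_procurement_profit[OF assms(1) T] mult_pos_pos[OF assms(4) add_nonneg_pos] by blast
qed

lemma DERIV_hq_profit:
  assumes "admissible_demand M" and T: "0 < transfer_price M e" "transfer_price M e < price M"
  shows "\<exists>l. (hq_profit M has_real_derivative l) (at e)"
proof -
  have eq: "hq_profit M = (\<lambda>e.
      (1 - tax M) * ((1 - royalty M) * retail_profit M e (order_quantity M e)
      - 1/2 * effort_cost M * e^2) + (1 - tax0 M) * procurement_profit M e)"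
    by (simp add: hq_profit_def procurement_profit_def fun_eq_iff)
  show ?thesis unfolding eq
    by (rule exI, rule DERIV_add[OF
          DERIV_cmult[OF DERIV_diff[OF DERIV_cmult[OF DERIV_optimal_retail_profit[OF assms]]
            DERIV_cmult[OF DERIV_power[OF DERIV_ident]]]]
          DERIV_cmult[OF DERIV_procurement_profit[OF assms]]])
qed

section \<open>Comparative statics in the tax gap\<close>

lemma with_tax_gap_simps [simp]:
  "price (with_tax_gap M \<Delta>) = price M" "cost0 (with_tax_gap M \<Delta>) = cost0 M"
  "effect (with_tax_gap M \<Delta>) = effect M" "effort_cost (with_tax_gap M \<Delta>) = effort_cost M"
  "markup (with_tax_gap M \<Delta>) = markup M" "royalty (with_tax_gap M \<Delta>) = royalty M"
  "tax (with_tax_gap M \<Delta>) = tax M" "tax0 (with_tax_gap M \<Delta>) = tax M - \<Delta>"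
  "salary (with_tax_gap M \<Delta>) = salary M" "demand (with_tax_gap M \<Delta>) = demand M"
  "demand_density (with_tax_gap M \<Delta>) = demand_density M"
  by (simp_all add: with_tax_gap_def)

lemma with_tax_gap_invariant [simp]:
  "expected_sales (with_tax_gap M \<Delta>) = expected_sales M"
  "unit_cost (with_tax_gap M \<Delta>) = unit_cost M"
  "transfer_price (with_tax_gap M \<Delta>) = transfer_price M"
  "feasible_efforts (with_tax_gap M \<Delta>) = feasible_efforts M"
  "retail_profit (with_tax_gap M \<Delta>) = retail_profit M"
  "order_quantity (with_tax_gap M \<Delta>) = order_quantity M"
  "procurement_profit (with_tax_gap M \<Delta>) = procurement_profit M"
  "admissible_demand (with_tax_gap M \<Delta>) = admissible_demand M"
  unfolding expected_sales_def[abs_def] unit_cost_def[abs_def] transfer_price_def[abs_def]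
    feasible_efforts_def retail_profit_def[abs_def] order_quantity_def[abs_def]
    procurement_profit_def[abs_def] admissible_demand_def gen_failure_rate_def[abs_def]
    with_tax_gap_simps
  by (rule refl)+

lemma hq_profit_tax_gap:
  "hq_profit (with_tax_gap M \<Delta>') e
     = hq_profit (with_tax_gap M \<Delta>) e + (\<Delta>' - \<Delta>) * procurement_profit M e"
  by (simp add: hq_profit_def procurement_profit_def algebra_simps)

text \<open>At an interior effort both constraints on the transfer price are strict, because it is strictly
  decreasing in effort. These are the efforts at which the order quantity is a quantile.\<close>
lemma interior_feasible_efforts:
  assumes "e \<in> interior (feasible_efforts M)" "0 < effect M" "0 < markup M"
  shows "0 < transfer_price M e" "transfer_price M e < price M"
proof -
  obtain d where d: "0 < d" "cball e d \<subseteq> feasible_efforts M"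
    using assms(1) unfolding mem_interior_cball by blast
  then have f: "e + d \<in> feasible_efforts M" "e - d \<in> feasible_efforts M"
    by (auto simp: subset_iff dist_real_def)
  have pos: "0 < effect M * d" using assms d by simp
  have "0 \<le> markup M * unit_cost M (e + d)"
    using f(1) by (simp add: feasible_efforts_def transfer_price_def algebra_simps)
  then have "0 \<le> unit_cost M (e + d)" using assms(3) by (simp add: zero_le_mult_iff)
  then have "0 < unit_cost M e" using pos by (simp add: unit_cost_def algebra_simps)
  then show "0 < transfer_price M e" using assms(3) by (simp add: transfer_price_def)
  have "unit_cost M e < unit_cost M (e - d)"
    using pos by (simp add: unit_cost_def algebra_simps)
  then have "transfer_price M e < transfer_price M (e - d)"
    using assms(3) by (simp add: transfer_price_def)
  also have "\<dots> \<le> price M" using f(2) by (simp add: feasible_efforts_def)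
  finally show "transfer_price M e < price M" .
qed

text \<open>Strict monotone comparative statics. If the maximizer decreased, adding the two optimality
  inequalities would give \<open>B e1 \<le> B e2\<close>, against the monotonicity of \<open>B\<close>. If it stayed the same, both
  first-order conditions would hold at one point, and their difference would be \<open>\<delta> B' = 0\<close>.\<close>
lemma interior_maximizer_strict_increase:
  fixes f f' B :: "real \<Rightarrow> real"
  assumes f': "\<And>e. f' e = f e + \<delta> * B e" and "0 < \<delta>"
    and max: "\<And>e. e \<in> X \<Longrightarrow> f e \<le> f e1" "\<And>e. e \<in> X \<Longrightarrow> f' e \<le> f' e2"
    and int: "e1 \<in> interior X" "e2 \<in> interior X"
    and df: "\<exists>l. (f has_real_derivative l) (at e1)"
    and dB: "\<And>e. min e1 e2 \<le> e \<Longrightarrow> e \<le> max e1 e2 \<Longrightarrow> \<exists>l. (B has_real_derivative l) (at e) \<and> 0 < l"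
  shows "e1 < e2"
proof (cases e1 e2 rule: linorder_cases)
  case greater
  have X: "e1 \<in> X" "e2 \<in> X" using int interior_subset by blast+
  have "B e2 < B e1"
  proof (rule DERIV_pos_imp_increasing[OF greater])
    fix e assume "e2 \<le> e" "e \<le> e1"
    then show "\<exists>l. (B has_real_derivative l) (at e) \<and> 0 < l" by (intro dB) auto
  qed
  then have "\<delta> * B e2 < \<delta> * B e1" using \<open>0 < \<delta>\<close> by simp
  then show ?thesis using max(1)[OF X(2)] max(2)[OF X(1)] f' by simp
next
  case equal
  obtain d where d: "0 < d" "ball e1 d \<subseteq> X" using int(1) unfolding mem_interior by blast
  obtain l where l: "(f has_real_derivative l) (at e1)" using df by blast
  obtain l' where l': "(B has_real_derivative l') (at e1)" "0 < l'" using dB[of e1] by auto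
  have "f' = (\<lambda>e. f e + \<delta> * B e)" using f' by blast
  then have "(f' has_real_derivative (l + \<delta> * l')) (at e1)"
    using l l' by (auto intro!: derivative_eq_intros)
  then have "l + \<delta> * l' = 0"
    using d max(2) equal by (intro DERIV_local_max[of f' _ e1 d]) (auto simp: dist_real_def)
  moreover have "l = 0"
    using d max(1) l by (intro DERIV_local_max[of f _ e1 d]) (auto simp: dist_real_def)
  ultimately show ?thesis using \<open>0 < \<delta>\<close> l' by simp
qed

lemma optimal_effort_max:
  assumes "admissible M" "e \<in> feasible_efforts M"
  shows "hq_profit M e \<le> hq_profit M (optimal_effort M)"
proof -
  have "\<exists>e. is_arg_max (hq_profit M) (\<lambda>e. e \<in> feasible_efforts M) e"
    using assms(1) by (auto simp: admissible_def)
  then have "is_arg_max (hq_profit M) (\<lambda>e. e \<in> feasible_efforts M) (optimal_effort M)"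
    unfolding optimal_effort_def arg_max_on_def arg_max_def by (rule someI_ex)
  then show ?thesis using assms(2) by (auto simp: is_arg_max_def not_less)
qed

lemma optimal_effort_increasing_in_tax_gap:
  assumes "markup M \<le> markup_threshold M"
  shows "strict_mono_on {\<Delta>. admissible (with_tax_gap M \<Delta>)} (\<lambda>\<Delta>. optimal_effort (with_tax_gap M \<Delta>))"
proof (rule strict_mono_onI)
  fix \<Delta> \<Delta>' :: real
  assume a: "\<Delta> \<in> {\<Delta>. admissible (with_tax_gap M \<Delta>)}" "\<Delta>' \<in> {\<Delta>. admissible (with_tax_gap M \<Delta>)}"
    and less: "\<Delta> < \<Delta>'"
  let ?e = "optimal_effort (with_tax_gap M \<Delta>)" and ?e' = "optimal_effort (with_tax_gap M \<Delta>')"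
  have pos: "0 < effect M" "0 < markup M" "royalty M < 1" "admissible_demand M"
    using a(1) by (auto simp: admissible_def)
  have int: "?e \<in> interior (feasible_efforts M)" "?e' \<in> interior (feasible_efforts M)"
    using a by (auto simp: admissible_def)
  note T = interior_feasible_efforts[OF int(1) pos(1,2)]
    and T' = interior_feasible_efforts[OF int(2) pos(1,2)]
  show "?e < ?e'"
  proof (rule interior_maximizer_strict_increase[OF hq_profit_tax_gap _ _ _ int])
    show "0 < \<Delta>' - \<Delta>" using less by simp
    show "hq_profit (with_tax_gap M \<Delta>) e \<le> hq_profit (with_tax_gap M \<Delta>) ?e"
      if "e \<in> feasible_efforts M" for e
      using optimal_effort_max[of "with_tax_gap M \<Delta>" e] a that by simp
    show "hq_profit (with_tax_gap M \<Delta>') e \<le> hq_profit (with_tax_gap M \<Delta>') ?e'"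
      if "e \<in> feasible_efforts M" for e
      using optimal_effort_max[of "with_tax_gap M \<Delta>'" e] a that by simp
    show "\<exists>l. (hq_profit (with_tax_gap M \<Delta>) has_real_derivative l) (at ?e)"
      using DERIV_hq_profit[of "with_tax_gap M \<Delta>" ?e] T pos by simp
    fix e assume e: "min ?e ?e' \<le> e" "e \<le> max ?e ?e'"
    have anti: "transfer_price M y \<le> transfer_price M x" if "x \<le> y" for x y
      using that pos by (auto simp: transfer_price_def unit_cost_def)
    have "0 < transfer_price M e" "transfer_price M e < price M"
      using anti[OF e(1)] anti[OF e(2)] T T' by (auto simp: min_def max_def split: if_splits)
    then show "\<exists>l. (procurement_profit M has_real_derivative l) (at e) \<and> 0 < l"
      using DERIV_procurement_profit_pos pos assms by blast
  qed
qed

section \<open>Uniform demand with a large markup\<close>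

text \<open>With \<open>m = 1 + \<alpha>\<close> and \<open>\<eta> = 1\<close> the order quantity is \<open>1 - \<gamma>(e) = 1/2 + e\<close>, and the feasible efforts are
  \<open>[0, 1/2]\<close>. As \<open>\<Delta>\<close> tends to 0 the optimal effort tends to \<open>1/k = 1/4\<close>, where the order quantity \<open>3/4\<close> lies in
  the region above \<open>2/3\<close> in which procurement profit decreases in effort.\<close>
definition uniform_model :: model
  where "uniform_model = \<lparr>price = 2, cost0 = 1/2, effect = 1, effort_cost = 4, markup = 1,
    royalty = 1/4, tax = 1/2, tax0 = 1/4, salary = 0,
    demand = density lborel (\<lambda>x. ennreal (indicator {0..1} x)),
    demand_density = indicator {0..1}\<rparr>"

lemma uniform_model_simps [simp]:
  "price uniform_model = 2" "cost0 uniform_model = 1/2" "effect uniform_model = 1"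
  "effort_cost uniform_model = 4" "markup uniform_model = 1" "royalty uniform_model = 1/4"
  "tax uniform_model = 1/2" "tax0 uniform_model = 1/4" "salary uniform_model = 0"
  "demand_density uniform_model = indicator {0..1}"
  by (simp_all add: uniform_model_def)

lemma emeasure_uniform_demand:
  assumes [measurable]: "A \<in> sets borel"
  shows "emeasure (demand uniform_model) A = emeasure lborel ({0..1} \<inter> A)"
  by (simp add: uniform_model_def emeasure_density ennreal_indicator
      indicator_inter_arith[symmetric])

lemma uniform_cdf: "demand_cdf uniform_model x = (if x < 0 then 0 else if x \<le> 1 then x else 1)"
proof -
  have "{0..1} \<inter> {..x} = {0..min 1 x}" by auto
  then show ?thesis
    by (simp add: cdf_def measure_def emeasure_uniform_demand min_def)
qed

lemma uniform_support: "support (demand uniform_model) = {0..1}"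
proof (rule set_eqI)
  fix x :: real
  have m: "measure (demand uniform_model) (ball x e) = measure lborel ({0..1} \<inter> ball x e)" for e
    by (simp add: measure_def emeasure_uniform_demand)
  show "x \<in> support (demand uniform_model) \<longleftrightarrow> x \<in> {0..1}"
  proof
    assume x: "x \<in> {0..1}"
    show "x \<in> support (demand uniform_model)"
      unfolding support_def
    proof (intro CollectI allI impI)
      fix e :: real assume "0 < e"
      then have "0 < measure lborel {max 0 (x - e) <..< min 1 (x + e)}"
        using x by auto
      also have "\<dots> \<le> measure lborel ({0..1} \<inter> ball x e)"
      proof (rule measure_mono_fmeasurable)
        show "{0..1} \<inter> ball x e \<in> fmeasurable lborel"
          by (rule fmeasurableI2[of "{0..1}"]) (auto intro: fmeasurableI)
      qed (auto simp: ball_eq_greaterThanLessThan)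
      finally show "0 < measure (demand uniform_model) (ball x e)" using m by simp
    qed
  next
    assume x: "x \<in> support (demand uniform_model)"
    show "x \<in> {0..1}"
    proof (rule ccontr)
      assume "x \<notin> {0..1}"
      then have "open (- {0..1::real})" "x \<in> - {0..1}" by auto
      then obtain e where "0 < e" "ball x e \<subseteq> - {0..1}" unfolding open_contains_ball by blast
      moreover from this have "{0..1} \<inter> ball x e = {}" by auto
      ultimately show False using x m by (auto simp: support_def)
    qed
  qed
qed

lemma admissible_uniform_demand: "admissible_demand uniform_model"
proof -
  have [simp]: "sets (demand uniform_model) = sets borel" "space (demand uniform_model) = UNIV"
    by (simp_all add: uniform_model_def)
  have "prob_space (demand uniform_model)"
    by (rule prob_spaceI) (simp add: emeasure_uniform_demand)
  then have "real_distribution (demand uniform_model)"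
    by (simp add: real_distribution_def real_distribution_axioms_def)
  moreover have "AE x in demand uniform_model. 0 \<le> x"
    unfolding uniform_model_def model.select_convs by (simp add: AE_density indicator_def)
  moreover have "strict_mono_on {0..1} (demand_cdf uniform_model)"
    by (auto intro!: strict_mono_onI simp: uniform_cdf)
  moreover have "continuous_on {0<..<1} (indicator {0..1} :: real \<Rightarrow> real)"
    by (rule continuous_on_eq[of _ "\<lambda>_. 1"]) auto
  moreover have "mono_on {0<..<1} (gen_failure_rate uniform_model)"
    by (auto intro!: mono_onI frac_le simp: gen_failure_rate_def uniform_cdf)
  ultimately show ?thesis
    unfolding admissible_demand_def uniform_support
    by (auto simp: uniform_model_def is_interval_cc)
qed

lemma uniform_expected_sales:
  assumes "0 \<le> y" "y \<le> 1"
  shows "expected_sales uniform_model y = y - y\<^sup>2 / 2"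
proof -
  have "(LBINT x:{0..y}. x * indicator {0..1} x) = (\<integral>x. x ^ 1 * indicator {0..y} x \<partial>lborel)"
    unfolding set_lebesgue_integral_def
    by (rule Bochner_Integration.integral_cong) (use assms in \<open>auto simp: indicator_def\<close>)
  also have "\<dots> = y\<^sup>2 / 2" using assms by (subst integral_power) (auto simp: power2_eq_square)
  finally have 1: "(LBINT x:{0..y}. x * indicator {0..1} x) = y\<^sup>2 / 2" .
  have "(LBINT x:{y..}. y * indicator {0..1} x) = (\<integral>x. y * indicator {y..1} x \<partial>lborel)"
    unfolding set_lebesgue_integral_def
    by (rule Bochner_Integration.integral_cong) (use assms in \<open>auto simp: indicator_def\<close>)
  also have "\<dots> = y * (1 - y)" using assms by simp
  finally have "(LBINT x:{y..}. y * indicator {0..1} x) = y * (1 - y)" .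
  with 1 show ?thesis by (simp add: expected_sales_def field_simps power2_eq_square)
qed

text \<open>The formula extends to the boundary effort \<open>1/2\<close>. There the transfer price is 0 and the order quantity
  is an unspecified maximizer, but it enters only through the maximal retail profit and through its
  product with the unit cost 0.\<close>
lemma uniform_hq_profit:
  assumes e: "e \<in> {0..1/2}"
  shows "hq_profit (with_tax_gap uniform_model \<Delta>) e =
    (1/2 + e) / 2 - e\<^sup>2 + \<Delta> * ((1/2 + e) - 3/4 * (1/2 + e)\<^sup>2)"
proof -
  let ?M = uniform_model and ?q = "order_quantity uniform_model e"
  have T: "transfer_price ?M e = 1 - 2 * e" by (simp add: transfer_price_def unit_cost_def)
  have max: "is_arg_max (retail_profit ?M e) (\<lambda>y. y \<in> {0..}) (1/2 + e)"
    by (rule is_arg_max_retail_profit[OF admissible_uniform_demand])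
      (use e in \<open>auto simp: uniform_cdf T field_simps\<close>)
  then have q: "is_arg_max (retail_profit ?M e) (\<lambda>y. y \<in> {0..}) ?q"
    unfolding order_quantity_def arg_max_on_def arg_max_def by (rule someI)
  have "retail_profit ?M e ?q = retail_profit ?M e (1/2 + e)"
    using max q unfolding is_arg_max_def by (meson antisym not_less)
  also have "\<dots> = (1/2 + e)\<^sup>2"
    using e by (simp add: retail_profit_def uniform_expected_sales)
      (simp add: field_simps power2_eq_square)
  finally have pi: "retail_profit ?M e ?q = (1/2 + e)\<^sup>2" .
  \<comment> \<open>At \<open>e = 1/2\<close> both sides vanish whatever the order quantity is.\<close>
  have gq: "(1/2 - e) * ?q = (1/2 - e) * (1/2 + e)"
  proof (cases "e = 1/2")
    case False
    then have T': "0 < transfer_price ?M e" "transfer_price ?M e < price ?M"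
      using e by (auto simp: T)
    have "quantile ?M (demand_cdf ?M (1/2 + e)) = 1/2 + e"
      by (rule quantile_cdf[OF admissible_uniform_demand])
        (use e False in \<open>auto simp: uniform_cdf\<close>)
    moreover have "demand_cdf ?M (1/2 + e) = 1 - transfer_price ?M e / price ?M"
      using e by (simp add: T uniform_cdf field_simps)
    ultimately have "?q = 1/2 + e"
      using order_quantity_eq_quantile(1)[OF admissible_uniform_demand T'] by simp
    then show ?thesis by simp
  qed simp
  show ?thesis
    by (simp add: hq_profit_def pi gq) (simp add: field_simps power2_eq_square)
qed

lemma uniform_feasible_efforts: "feasible_efforts uniform_model = {0..1/2}"
  by (auto simp: feasible_efforts_def transfer_price_def unit_cost_def)

text \<open>Completing the square: the objective is a constant minus \<open>(1 + 3/4 \<Delta>) (e - e\<^sub>0)\<^sup>2\<close> with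
  \<open>e\<^sub>0 = (2 + \<Delta>) / (8 + 6 \<Delta>)\<close>, and \<open>e\<^sub>0\<close> lies strictly between 0 and \<open>1/2\<close>.\<close>
lemma uniform_optimal_effort:
  assumes "0 < \<Delta>" "\<Delta> \<le> 1/2"
  shows "optimal_effort (with_tax_gap uniform_model \<Delta>) = (2 + \<Delta>) / (8 + 6 * \<Delta>)"
    and "admissible (with_tax_gap uniform_model \<Delta>)"
proof -
  let ?M = "with_tax_gap uniform_model \<Delta>" and ?e = "(2 + \<Delta>) / (8 + 6 * \<Delta>)"
  let ?P = "\<lambda>e. e \<in> feasible_efforts ?M"
  have e0: "0 < ?e" "?e < 1/2" using assms by (auto simp: field_simps)
  have sq: "hq_profit ?M e = hq_profit ?M ?e - (1 + 3/4 * \<Delta>) * (e - ?e)\<^sup>2" if "e \<in> {0..1/2}" for e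
  proof -
    define c where "c = ?e"
    have c: "2 + \<Delta> = c * (8 + 6 * \<Delta>)" using assms by (simp add: c_def)
    have "c \<in> {0..1/2}" using e0 by (simp add: c_def)
    then have "hq_profit ?M e - hq_profit ?M c + (1 + 3/4 * \<Delta>) * (e - c)\<^sup>2
        = (e - c) * ((2 + \<Delta>) - c * (8 + 6 * \<Delta>)) / 4"
      unfolding uniform_hq_profit[OF that] uniform_hq_profit[OF \<open>c \<in> _\<close>]
      by (simp add: field_simps power2_eq_square)
    also have "\<dots> = 0" unfolding c by simp
    finally show ?thesis unfolding c_def by linarith
  qed
  have less: "hq_profit ?M e < hq_profit ?M ?e" if "e \<in> {0..1/2}" "e \<noteq> ?e" for e
  proof -
    have "0 < 1 + 3/4 * \<Delta>" using assms by simp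
    moreover have "0 < (e - ?e)\<^sup>2" using that(2) unfolding zero_less_power2 by simp
    ultimately have "0 < (1 + 3/4 * \<Delta>) * (e - ?e)\<^sup>2" by (rule mult_pos_pos)
    then show ?thesis using sq[OF that(1)] by linarith
  qed
  have "?e \<in> {0..1/2}" using e0 by simp
  have iff: "is_arg_max (hq_profit ?M) ?P e \<longleftrightarrow> e = ?e" for e
  proof
    assume "is_arg_max (hq_profit ?M) ?P e"
    then have "e \<in> {0..1/2}" "\<not> hq_profit ?M e < hq_profit ?M ?e"
      using \<open>?e \<in> _\<close>
      unfolding is_arg_max_def with_tax_gap_invariant uniform_feasible_efforts by blast+
    then show "e = ?e" using less by blast
  next
    assume e: "e = ?e"
    have "\<not> hq_profit ?M ?e < hq_profit ?M e'" if "e' \<in> {0..1/2}" for e'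
      using less[OF that] by (cases "e' = ?e") (simp, linarith)
    then show "is_arg_max (hq_profit ?M) ?P e"
      using \<open>?e \<in> _\<close>
      unfolding e is_arg_max_def with_tax_gap_invariant uniform_feasible_efforts by blast
  qed
  then show opt: "optimal_effort ?M = ?e"
    by (simp add: optimal_effort_def arg_max_on_def arg_max_def)
  have "\<exists>!e. is_arg_max (hq_profit ?M) ?P e" unfolding iff by simp
  moreover have "optimal_effort ?M \<in> interior (feasible_efforts ?M)"
    unfolding opt using e0 by (simp add: uniform_feasible_efforts)
  ultimately show "admissible ?M"
    using assms admissible_uniform_demand unfolding admissible_def by simp
qed

theorem proposition1:
  "(\<forall>M. markup M \<le> markup_threshold M \<longrightarrow>
      strict_mono_on {\<Delta>. admissible (with_tax_gap M \<Delta>)} (\<lambda>\<Delta>. optimal_effort (with_tax_gap M \<Delta>)))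
   \<and>
   (\<exists>M. admissible M \<and> markup M > markup_threshold M \<and>
      (\<exists>l u. l < u \<and> (\<forall>\<Delta>\<in>{l..u}. admissible (with_tax_gap M \<Delta>)) \<and>
        strict_antimono_on {l..u} (\<lambda>\<Delta>. optimal_effort (with_tax_gap M \<Delta>))))"
proof (intro conjI allI impI)
  fix M assume "markup M \<le> markup_threshold M"
  then show "strict_mono_on {\<Delta>. admissible (with_tax_gap M \<Delta>)}
      (\<lambda>\<Delta>. optimal_effort (with_tax_gap M \<Delta>))"
    by (rule optimal_effort_increasing_in_tax_gap)
next
  let ?M = uniform_model
  have "admissible (with_tax_gap ?M (1/4))" by (rule uniform_optimal_effort(2)) simp_all
  then have "admissible ?M" by (simp add: with_tax_gap_def uniform_model_def)
  moreover have "markup ?M > markup_threshold ?M" by (simp add: markup_threshold_def)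
  moreover have "\<forall>\<Delta>\<in>{1/4..1/2}. admissible (with_tax_gap ?M \<Delta>)"
    by (intro ballI uniform_optimal_effort(2)) simp_all
  moreover have "strict_antimono_on {1/4..1/2} (\<lambda>\<Delta>. optimal_effort (with_tax_gap ?M \<Delta>))"
  proof (rule monotone_onI)
    fix \<Delta> \<Delta>' :: real assume "\<Delta> \<in> {1/4..1/2}" "\<Delta>' \<in> {1/4..1/2}" "\<Delta> < \<Delta>'"
    then show "optimal_effort (with_tax_gap ?M \<Delta>) > optimal_effort (with_tax_gap ?M \<Delta>')"
      by (simp add: uniform_optimal_effort(1) field_simps)
  qed
  ultimately show "\<exists>M. admissible M \<and> markup M > markup_threshold M \<and>
      (\<exists>l u. l < u \<and> (\<forall>\<Delta>\<in>{l..u}. admissible (with_tax_gap M \<Delta>)) \<and>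
        strict_antimono_on {l..u} (\<lambda>\<Delta>. optimal_effort (with_tax_gap M \<Delta>)))"
    by (intro exI[of _ ?M] conjI exI[of _ "1/4"] exI[of _ "1/2"]) simp_all
qed

end
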